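(* Projectifications and quotients of crystallographs are commutative operations: if $\mathcal{G}'\subseteq\mathcal{G}$ are nested crystallographs on the same set of nodes, both disjoint unions of graphs of type $A$, $B$, $C$, $D$ and $BC$, then there is an equality of edge-coloured (trichromatic) graphs $$\mathbb{P}(\mathcal{G})\setminus\mathbb{P}(\mathcal{G}')=\mathbb{P}\bigl(\mathcal{G}\setminus\mathcal{G}'\bigr),$$ where "$\setminus$" denotes the quotient graph and $\mathbb{P}$ the projectification.
   Context: Bichromatic graphs: finite set of nodes, unoriented straight edges $\{i,j\}$ ($i\ne j$) and loop edges $\{k\}$, each coloured red or green, such that two distinct edges with the same underlying node set have different colours. Trichromatic graphs: the same with colours red, green, blue. Crystallograph: a bichromatic graph such that (1) for any three distinct nodes $i,j,k$, if there are straight edges $\{i,j\}$, $\{j,k\}$ then there is a straight edge $\{i,k\}$, red if the first two have the same colour and green otherwise; (2) if a node $i$ is incident to a loop edge and to a straight edge $\{i,j\}$, then both the red and the green straight edge $\{i,j\}$ are present, as well as a loop edge at $j$ of the same colour as the one at $i$. Graphs on $m\ge1$ nodes: type $A$: exactly all red straight edges (an isolated node for $m=1$); type $D$ ($m\geq 2$): exactly all red and green straight edges; type $B$ (resp. $C$, $BC$): all red and green straight edges and a red (resp. green, resp. both a red and a green) loop at every node. Projectification $\mathbb{P}(\mathcal{G})$ of a bichromatic graph: same nodes and straight edges, with a single blue loop at each node of $\mathcal{G}$ carrying at least one loop, and no other loops. In a crystallograph which is a disjoint union of graphs of type $A$, $B$, $C$, $D$ and $BC$, or in the projectification of such a crystallograph,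 a "red component" is a connected component of type $A$ (no loops, isolated nodes included); any other connected component is called bichromatic. Quotient $\mathcal{G}\setminus\mathcal{G}'$ of crystallographs: nodes are the red components of $\mathcal{G}'$, edges exactly the following. (i) If $\mathcal{G}$ has a straight edge between nodes of two distinct red components $\mathcal{G}'(i)$, $\mathcal{G}'(j)$ of $\mathcal{G}'$, put a straight edge of the same colour between them. (ii) If $\mathcal{G}$ has a green straight edge between two nodes of a red component $\mathcal{G}'(i)$, put a green loop at $\mathcal{G}'(i)$. (iii) If $\mathcal{G}$ has a straight edge from a node of a red component $\mathcal{G}'(i)$ to a node of a bichromatic component of $\mathcal{G}'$, put a red loop at $\mathcal{G}'(i)$. (iv) If $\mathcal{G}$ has a loop edge at a node of a red component $\mathcal{G}'(i)$, put a loop of the same colour at $\mathcal{G}'(i)$. (At most one edge per colour is kept.) Quotient $\mathbb{P}(\mathcal{G})\setminus\mathbb{P}(\mathcal{G}')$: defined by the same rules (applied to $\mathbb{P}(\mathcal{G}')\subseteq\mathbb{P}(\mathcal{G})$), except that all loops that are put in (ii), (iii), (iv) are blue (at most one per node). Red components of $\mathcal{G}'$ and of $\mathbb{P}(\mathcal{G}')$ coincide, so both sides have the same set of nodes. *)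

theory Defs
  imports Main
begin

datatype colour = Red | Green | Blue

text \<open>
  An edge is a pair of its underlying node set (of size 2 for a straight edge, of size 1 for
  a loop) and its colour. As the edges form a set of such pairs, distinct edges with the same
  underlying node set automatically have different colours.
\<close>

record 'a cgraph =
  nodes :: "'a set"
  edges :: "('a set \<times> colour) set"

definition trichromatic :: "'a cgraph \<Rightarrow> bool" where
  "trichromatic G \<longleftrightarrow> finite (nodes G) \<and>
     (\<forall>(e, c) \<in> edges G. e \<subseteq> nodes G \<and> (card e = 1 \<or> card e = 2))"

definition bichromatic :: "'a cgraph \<Rightarrow> bool" where
  "bichromatic G \<longleftrightarrow> trichromatic G \<and> (\<forall>(e, c) \<in> edges G. c \<in> {Red, Green})"

definition has_straight :: "'a cgraph \<Rightarrow> 'a \<Rightarrow> 'a \<Rightarrow> colour \<Rightarrow> bool" where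
  "has_straight G i j c \<longleftrightarrow> i \<noteq> j \<and> ({i, j}, c) \<in> edges G"

definition has_loop :: "'a cgraph \<Rightarrow> 'a \<Rightarrow> colour \<Rightarrow> bool" where
  "has_loop G i c \<longleftrightarrow> ({i}, c) \<in> edges G"

definition crystallograph :: "'a cgraph \<Rightarrow> bool" where
  "crystallograph G \<longleftrightarrow> bichromatic G \<and>
     (\<forall>i\<in>nodes G. \<forall>j\<in>nodes G. \<forall>k\<in>nodes G. \<forall>c d.
        i \<noteq> j \<and> j \<noteq> k \<and> i \<noteq> k \<and> has_straight G i j c \<and> has_straight G j k d \<longrightarrow>
          has_straight G i k (if c = d then Red else Green)) \<and>
     (\<forall>i\<in>nodes G. \<forall>j\<in>nodes G. \<forall>c d.
        has_loop G i c \<and> has_straight G i j d \<longrightarrow>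
          has_straight G i j Red \<and> has_straight G i j Green \<and> has_loop G j c)"

definition all_straight :: "'a set \<Rightarrow> colour \<Rightarrow> ('a set \<times> colour) set" where
  "all_straight X c = {({i, j}, c) | i j. i \<in> X \<and> j \<in> X \<and> i \<noteq> j}"

definition all_loops :: "'a set \<Rightarrow> colour \<Rightarrow> ('a set \<times> colour) set" where
  "all_loops X c = {({i}, c) | i. i \<in> X}"

definition type_A :: "'a cgraph \<Rightarrow> bool" where
  "type_A G \<longleftrightarrow> finite (nodes G) \<and> card (nodes G) \<ge> 1 \<and>
     edges G = all_straight (nodes G) Red"

definition type_D :: "'a cgraph \<Rightarrow> bool" where
  "type_D G \<longleftrightarrow> finite (nodes G) \<and> card (nodes G) \<ge> 2 \<and>
     edges G = all_straight (nodes G) Red \<union> all_straight (nodes G) Green"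

definition type_B :: "'a cgraph \<Rightarrow> bool" where
  "type_B G \<longleftrightarrow> finite (nodes G) \<and> card (nodes G) \<ge> 1 \<and>
     edges G = all_straight (nodes G) Red \<union> all_straight (nodes G) Green
       \<union> all_loops (nodes G) Red"

definition type_C :: "'a cgraph \<Rightarrow> bool" where
  "type_C G \<longleftrightarrow> finite (nodes G) \<and> card (nodes G) \<ge> 1 \<and>
     edges G = all_straight (nodes G) Red \<union> all_straight (nodes G) Green
       \<union> all_loops (nodes G) Green"

definition type_BC :: "'a cgraph \<Rightarrow> bool" where
  "type_BC G \<longleftrightarrow> finite (nodes G) \<and> card (nodes G) \<ge> 1 \<and>
     edges G = all_straight (nodes G) Red \<union> all_straight (nodes G) Green
       \<union> all_loops (nodes G) Red \<union> all_loops (nodes G) Green"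

definition disjoint_union_ABCD_BC :: "'a cgraph \<Rightarrow> bool" where
  "disjoint_union_ABCD_BC G \<longleftrightarrow>
     (\<exists>F. (\<forall>H\<in>F. type_A H \<or> type_B H \<or> type_C H \<or> type_D H \<or> type_BC H) \<and>
          (\<forall>H\<in>F. \<forall>K\<in>F. H \<noteq> K \<longrightarrow> nodes H \<inter> nodes K = {}) \<and>
          nodes G = (\<Union>H\<in>F. nodes H) \<and> edges G = (\<Union>H\<in>F. edges H))"

definition nested :: "'a cgraph \<Rightarrow> 'a cgraph \<Rightarrow> bool" where
  "nested G' G \<longleftrightarrow> nodes G' = nodes G \<and> edges G' \<subseteq> edges G"

definition projectification :: "'a cgraph \<Rightarrow> 'a cgraph" where
  "projectification G =
     \<lparr>nodes = nodes G,
      edges = {({i, j}, c) | i j c. has_straight G i j c}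
        \<union> {({i}, Blue) | i. i \<in> nodes G \<and> (\<exists>c. has_loop G i c)}\<rparr>"

definition connectivity :: "'a cgraph \<Rightarrow> ('a \<times> 'a) set" where
  "connectivity G =
     {(i, j). i \<in> nodes G \<and> j \<in> nodes G \<and> (\<exists>c. has_straight G i j c)}\<^sup>* \<inter> nodes G \<times> nodes G"

definition induced :: "'a cgraph \<Rightarrow> 'a set \<Rightarrow> 'a cgraph" where
  "induced G X = \<lparr>nodes = X, edges = {(e, c). (e, c) \<in> edges G \<and> e \<subseteq> X}\<rparr>"

definition components :: "'a cgraph \<Rightarrow> 'a cgraph set" where
  "components G = induced G ` (nodes G // connectivity G)"

definition red_components :: "'a cgraph \<Rightarrow> 'a cgraph set" where
  "red_components G = {H \<in> components G. type_A H}"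

definition bichromatic_components :: "'a cgraph \<Rightarrow> 'a cgraph set" where
  "bichromatic_components G = components G - red_components G"

text \<open>
  The two quotients differ only in the colours of the loops they create: a loop that rules (ii),
  (iii), (iv) give the colour \<open>c\<close> is drawn in colour \<open>f c\<close>. The nodes of the quotient are the
  red components themselves, hence the nested type. The rules appear in the order (i) to (iv).
\<close>

definition quotient_with ::
    "(colour \<Rightarrow> colour) \<Rightarrow> 'a cgraph \<Rightarrow> 'a cgraph \<Rightarrow> 'a cgraph cgraph" where
  "quotient_with f G G' =
     \<lparr>nodes = red_components G',
      edges =
        {({H, K}, c) | H K c. H \<in> red_components G' \<and> K \<in> red_components G' \<and> H \<noteq> K \<and>
           (\<exists>u\<in>nodes H. \<exists>v\<in>nodes K. has_straight G u v c)}
        \<union> {({H}, f Green) | H. H \<in> red_components G' \<and>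
           (\<exists>u\<in>nodes H. \<exists>v\<in>nodes H. has_straight G u v Green)}
        \<union> {({H}, f Red) | H. H \<in> red_components G' \<and>
           (\<exists>K\<in>bichromatic_components G'. \<exists>u\<in>nodes H. \<exists>v\<in>nodes K. \<exists>c. has_straight G u v c)}
        \<union> {({H}, f c) | H c. H \<in> red_components G' \<and> (\<exists>u\<in>nodes H. has_loop G u c)}\<rparr>"

definition quotient_graph :: "'a cgraph \<Rightarrow> 'a cgraph \<Rightarrow> 'a cgraph cgraph" where
  "quotient_graph G G' = quotient_with (\<lambda>c. c) G G'"

definition projective_quotient :: "'a cgraph \<Rightarrow> 'a cgraph \<Rightarrow> 'a cgraph cgraph" where
  "projective_quotient G G' = quotient_with (\<lambda>_. Blue) G G'"

end

theory Submission
  imports Defs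
begin

text \<open>
  Projectification keeps the nodes and the straight edges, and it keeps the information whether
  a node carries a loop; all it forgets is the colour of the loops. The theorem holds because the
  quotient makes no other use of its two arguments, apart from copying colours of loops.

  The divisor \<open>G'\<close> enters through its components. These are cut out by the straight edges alone,
  so the components of \<open>\<P>(G')\<close> are the projectifications of the components of \<open>G'\<close>
  (\<open>components_projectification\<close>). Being of type \<open>A\<close> forces the absence of loops, hence it is
  neither created nor destroyed by projectification, and a red component is literally its own
  projectification. So \<open>G'\<close> and \<open>\<P>(G')\<close> have the same red components
  (\<open>red_components_projectification\<close>), and their bichromatic components have the same nodes
  (\<open>bichromatic_components_projectification\<close>).

  The dividend \<open>G\<close> enters only through its straight edges and its loops at nodes of red
  components. Rule (i) therefore gives the same edges on both sides. On the left, there is a blue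
  loop at a red component if and only if one of the rules (ii), (iii), (iv) applies to it; on the
  right the same rules produce loops of various colours, which the outer projectification
  merges into one blue loop.
\<close>

section \<open>Straight edges and loops of a projectification\<close>

lemma nodes_projectification [simp]: "nodes (projectification G) = nodes G"
  by (simp add: projectification_def)

lemma has_straight_projectification [simp]:
  "has_straight (projectification G) i j c \<longleftrightarrow> has_straight G i j c"
  by (auto simp: projectification_def has_straight_def doubleton_eq_iff insert_commute)

lemma has_loop_projectification [simp]:
  "has_loop (projectification G) i c \<longleftrightarrow> c = Blue \<and> i \<in> nodes G \<and> (\<exists>d. has_loop G i d)"
  by (auto simp: projectification_def has_loop_def has_straight_def)

lemma trichromatic_edge_cases:
  assumes "trichromatic G" and "(e, c) \<in> edges G"
  obtains (straight) i j where "e = {i, j}" "has_straight G i j c"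
    | (loop) i where "e = {i}" "i \<in> nodes G" "has_loop G i c"
proof -
  have "e \<subseteq> nodes G" and "card e = 1 \<or> card e = 2"
    using assms by (auto simp: trichromatic_def)
  then consider i where "e = {i}" "i \<in> nodes G" | i j where "e = {i, j}" "i \<noteq> j"
    by (auto simp: card_1_singleton_iff card_2_iff)
  then show thesis
    using assms(2) that by cases (auto simp: has_straight_def has_loop_def)
qed

lemma projectification_loopless:
  assumes "trichromatic G" and "\<And>i c. \<not> has_loop G i c"
  shows "projectification G = G"
proof -
  have "edges G = {({i, j}, c) | i j c. has_straight G i j c}"
    using assms by (fastforce elim: trichromatic_edge_cases simp: has_straight_def)
  then show ?thesis
    using assms(2) by (simp add: projectification_def)
qed

section \<open>Graphs of type A\<close>

lemma type_A_loopless: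
  assumes "type_A G"
  shows "\<not> has_loop G i c"
  using assms by (auto simp: type_A_def all_straight_def has_loop_def)

lemma type_A_trichromatic:
  assumes "type_A G"
  shows "trichromatic G"
  using assms by (auto simp: type_A_def all_straight_def trichromatic_def)

lemma projectification_type_A:
  assumes "type_A G"
  shows "projectification G = G"
  using assms by (intro projectification_loopless type_A_trichromatic type_A_loopless)

text \<open>
  Any loop of \<open>G\<close> leaves a blue loop in the projectification, so if the latter is of
  type \<open>A\<close>, then there was no loop in \<open>G\<close> to begin with, and nothing has changed.
\<close>

lemma type_A_projectification_iff:
  assumes "trichromatic G"
  shows "type_A (projectification G) \<longleftrightarrow> type_A G"
proof
  assume A: "type_A (projectification G)"
  have "\<not> has_loop G i c" for i c
  proof
    assume loop: "has_loop G i c"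
    then have "i \<in> nodes G"
      using assms by (auto simp: has_loop_def trichromatic_def)
    with loop have "has_loop (projectification G) i Blue"
      by auto
    with A show False
      by (simp add: type_A_loopless del: has_loop_projectification)
  qed
  with assms A show "type_A G"
    by (simp add: projectification_loopless)
qed (simp add: projectification_type_A)

section \<open>Components of a projectification\<close>

lemma connectivity_projectification [simp]:
  "connectivity (projectification G) = connectivity G"
  by (simp add: connectivity_def)

lemma nodes_induced [simp]: "nodes (induced G X) = X"
  by (simp add: induced_def)

lemma component_subset_nodes:
  assumes "X \<in> nodes G // connectivity G"
  shows "X \<subseteq> nodes G"
  using assms by (auto simp: quotient_def connectivity_def)

lemma red_component_subset_nodes:
  assumes "H \<in> red_components G"
  shows "nodes H \<subseteq> nodes G"
  using assms component_subset_nodes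
  by (fastforce simp: red_components_def components_def)

lemma trichromatic_induced:
  assumes "trichromatic G" and "X \<subseteq> nodes G"
  shows "trichromatic (induced G X)"
  using assms by (auto simp: trichromatic_def induced_def intro: finite_subset)

lemma trichromatic_component:
  assumes "trichromatic G" and "H \<in> components G"
  shows "trichromatic H"
  using assms
  by (auto simp: components_def intro: trichromatic_induced dest: component_subset_nodes)

lemma induced_projectification:
  assumes "X \<subseteq> nodes G"
  shows "induced (projectification G) X = projectification (induced G X)"
  using assms
  by (auto simp: induced_def projectification_def has_straight_def has_loop_def) blast

lemma components_projectification:
  "components (projectification G) = projectification ` components G"
  unfolding components_def image_image
  by (intro image_cong) (auto intro!: induced_projectification dest: component_subset_nodes)

lemma red_components_projectification:
  assumes "trichromatic G"
  shows "red_components (projectification G) = red_components G"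
proof -
  have "red_components (projectification G) = projectification ` red_components G"
    using trichromatic_component[OF assms]
    by (auto simp: red_components_def components_projectification type_A_projectification_iff)
  also have "\<dots> = red_components G"
    by (auto simp: red_components_def projectification_type_A image_iff)
  finally show ?thesis .
qed

text \<open>
  In contrast to the red components, the bichromatic ones may change, as their loops are
  recoloured; the quotient, however, uses only their nodes.
\<close>

lemma bichromatic_components_projectification:
  fixes G :: "'a cgraph"
  assumes "trichromatic G"
  shows "bichromatic_components (projectification G) =
           projectification ` bichromatic_components G"
proof -
  have "bichromatic_components K = {H \<in> components K. \<not> type_A H}" for K :: "'a cgraph"
    by (auto simp: bichromatic_components_def red_components_def)
  then show ?thesis
    using trichromatic_component[OF assms]
    by (auto simp: components_projectification type_A_projectification_iff)
qed

section \<open>Quotients and projectification\<close>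

lemma nodes_quotient_with [simp]: "nodes (quotient_with f G G') = red_components G'"
  by (simp add: quotient_with_def)

text \<open>
  The three rules that put a loop at the red component \<open>H\<close>, without regard to its colour: in
  this form they can be compared before and after projectification.
\<close>

definition loop_rule_applies :: "'a cgraph \<Rightarrow> 'a cgraph \<Rightarrow> 'a cgraph \<Rightarrow> bool" where
  "loop_rule_applies G G' H \<longleftrightarrow>
     (\<exists>u\<in>nodes H. \<exists>v\<in>nodes H. has_straight G u v Green) \<or>
     (\<exists>K\<in>bichromatic_components G'. \<exists>u\<in>nodes H. \<exists>v\<in>nodes K. \<exists>c. has_straight G u v c) \<or>
     (\<exists>u\<in>nodes H. \<exists>c. has_loop G u c)"

lemma has_straight_commute: "has_straight G u v c \<longleftrightarrow> has_straight G v u c"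
  by (auto simp: has_straight_def insert_commute)

lemma has_straight_quotient_with:
  "has_straight (quotient_with f G G') H K c \<longleftrightarrow>
     H \<in> red_components G' \<and> K \<in> red_components G' \<and> H \<noteq> K \<and>
     (\<exists>u\<in>nodes H. \<exists>v\<in>nodes K. has_straight G u v c)"
proof -
  let ?joined = "\<lambda>L M. L \<in> red_components G' \<and> M \<in> red_components G' \<and> L \<noteq> M \<and>
    (\<exists>u\<in>nodes L. \<exists>v\<in>nodes M. has_straight G u v c)"
  \<comment> \<open>The edge \<open>{H, K}\<close> may stem from rule (i) with the roles of \<open>H\<close> and \<open>K\<close> exchanged.\<close>
  have sym: "?joined H K \<longleftrightarrow> ?joined K H"
    using has_straight_commute by metis
  have "has_straight (quotient_with f G G') H K c \<longleftrightarrow>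
          H \<noteq> K \<and> (\<exists>L M. {H, K} = {L, M} \<and> ?joined L M)"
    unfolding has_straight_def[of "quotient_with f G G'"]
    by (cases "H = K") (simp_all add: quotient_with_def)
  also have "\<dots> \<longleftrightarrow> H \<noteq> K \<and> (?joined H K \<or> ?joined K H)"
    unfolding doubleton_eq_iff by metis
  also have "\<dots> \<longleftrightarrow> ?joined H K"
    using sym by metis
  finally show ?thesis .
qed

lemma ex_loop_quotient_with:
  "(\<exists>c. has_loop (quotient_with f G G') H c) \<longleftrightarrow>
     H \<in> red_components G' \<and> loop_rule_applies G G' H"
  unfolding has_loop_def[of "quotient_with f G G'"]
  by (simp add: quotient_with_def loop_rule_applies_def conj_disj_distribL ex_disj_distrib) blast

lemma projective_quotient_eq:
  "projective_quotient G G' =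
     \<lparr>nodes = red_components G',
      edges = {({H, K}, c) | H K c. H \<in> red_components G' \<and> K \<in> red_components G' \<and> H \<noteq> K \<and>
                 (\<exists>u\<in>nodes H. \<exists>v\<in>nodes K. has_straight G u v c)}
        \<union> {({H}, Blue) | H. H \<in> red_components G' \<and> loop_rule_applies G G' H}\<rparr>"
  unfolding projective_quotient_def quotient_with_def loop_rule_applies_def by auto

lemma projectification_quotient_eq:
  "projectification (quotient_graph G G') = projective_quotient G G'"
  unfolding projectification_def quotient_graph_def projective_quotient_eq
  by (simp add: has_straight_quotient_with ex_loop_quotient_with)

text \<open>
  The loops at nodes outside of \<open>G\<close> would be lost in the projectification; the red components
  of \<open>G'\<close> have no such nodes, since \<open>G\<close> and \<open>G'\<close> have the same ones.
\<close>

lemma loop_rule_applies_projectification: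
  assumes "trichromatic G'" and "nodes G' = nodes G" and "H \<in> red_components G'"
  shows "loop_rule_applies (projectification G) (projectification G') H \<longleftrightarrow>
           loop_rule_applies G G' H"
proof -
  have "nodes H \<subseteq> nodes G"
    using red_component_subset_nodes[OF assms(3)] assms(2) by simp
  then show ?thesis
    by (auto simp: loop_rule_applies_def bichromatic_components_projectification[OF assms(1)])
qed

lemma projective_quotient_projectification:
  assumes "trichromatic G'" and "nodes G' = nodes G"
  shows "projective_quotient (projectification G) (projectification G') =
           projective_quotient G G'"
  unfolding projective_quotient_eq red_components_projectification[OF assms(1)]
  by (simp add: loop_rule_applies_projectification[OF assms] cong: conj_cong)

theorem lemma7p4p3:
  fixes G G' :: "'a cgraph"
  assumes "crystallograph G" and "crystallograph G'"
    and "nested G' G"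
    and "disjoint_union_ABCD_BC G" and "disjoint_union_ABCD_BC G'"
  shows "projective_quotient (projectification G) (projectification G') =
           projectification (quotient_graph G G')"
proof -
  have "trichromatic G'" and "nodes G' = nodes G"
    using assms(2,3) by (simp_all add: crystallograph_def bichromatic_def nested_def)
  then show ?thesis
    by (simp add: projective_quotient_projectification projectification_quotient_eq)
qed

end
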